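(* Let $X$ be a (real or complex) normed space with norm $\|\cdot\|$. For any sequence $(A_n)_{n\in\mathbb N}$ of convex nowhere dense sets in $X$ and any sequence $(\varepsilon_n)_{n\in\mathbb N}$ of positive real numbers with $\lim_{n\to\infty}\varepsilon_n=0$, the set $$A=\{x\in X:\ \forall n\in\mathbb N\ \ \exists a\in A_n\ \ \|x-a\|<\varepsilon_n\}$$ is convex and nowhere dense in $X$.
   Context: A subset of a topological space is nowhere dense if its closure has empty interior. Completeness of $X$ is not assumed. *)

theory Defs
  imports "HOL-Analysis.Analysis"
begin

definition nowhere_dense :: "'a::topological_space set \<Rightarrow> bool"
  where "nowhere_dense S \<longleftrightarrow> interior (closure S) = {}"

end

(* The set lies in the e_n-neighbourhood of A_n. If its closure contained a ball of radius r,
   then for 2 e_n < r every point of that ball would be within s = 2 e_n of A_n, and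
   Radstrom's cancellation law, applied to ball (r - s) + ball s <= A_n + ball s, would put the
   concentric ball of radius r - s into the closure of A_n. *)
theory Submission
  imports Defs
begin

text \<open>Iterating the hypothesis gives \<open>y + b\<^sub>i = c\<^sub>i + b\<^sub>i\<^sub>+\<^sub>1\<close> with bounded \<open>b\<^sub>i\<close>; averaging
  telescopes, so the means of the \<open>c\<^sub>i\<close> converge to \<open>y\<close>. Neither completeness nor Hahn-Banach
  is involved.\<close>

lemma convex_cancel_ball:
  fixes C :: "'a::real_normed_vector set"
  assumes "convex C" and "s > 0"
    and step: "\<And>b. norm b < s \<Longrightarrow> \<exists>c\<in>C. norm (y + b - c) < s"
  shows "y \<in> closure C"
proof -
  \<comment> \<open>Starting from \<open>b_0 = 0\<close>, telescoping makes \<open>b_(n+1)\<close>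
    equal to \<open>n + 1\<close> times the gap between \<open>y\<close> and the mean
    \<open>c\<close> of \<open>c_0, ..., c_n\<close>.\<close>
  have mean: "\<exists>c\<in>C. norm (real (Suc n) *\<^sub>R (y - c)) < s" for n
  proof (induction n)
    case 0
    show ?case
      using step[of 0] \<open>s > 0\<close> by simp
  next
    case (Suc n)
    then obtain c where c: "c \<in> C" "norm (real (Suc n) *\<^sub>R (y - c)) < s"
      by blast
    \<comment> \<open>The scaled gap of the old mean is shorter than \<open>s\<close>, so it can
      serve as the next \<open>b\<close>.\<close>
    from step[OF c(2)] obtain d
      where d: "d \<in> C" "norm (y + real (Suc n) *\<^sub>R (y - c) - d) < s"
      by blast
    let ?t = "real (Suc (Suc n))"
    let ?c = "(real (Suc n) / ?t) *\<^sub>R c + (1 / ?t) *\<^sub>R d"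
    have "?c \<in> C"
      using \<open>convex C\<close> c(1) d(1) by (rule convexD) (auto simp: field_simps)
    moreover have "?t *\<^sub>R (y - ?c) = y + real (Suc n) *\<^sub>R (y - c) - d"
    proof -
      have "?t *\<^sub>R ?c = real (Suc n) *\<^sub>R c + d"
        by (simp add: scaleR_add_right del: of_nat_Suc)
      moreover have "?t *\<^sub>R y = y + real (Suc n) *\<^sub>R y"
        by (metis of_nat_Suc scaleR_add_left scaleR_one)
      ultimately show ?thesis
        by (simp only: scaleR_diff_right) (simp del: of_nat_Suc)
    qed
    ultimately show ?case
      using d(2) by metis
  qed
  show ?thesis
    unfolding closure_approachable
  proof (intro allI impI)
    fix e :: real
    assume "e > 0"
    then obtain n where n: "s < real n * e"
      using ex_less_of_nat_mult by blast
    from mean[of n] obtain c where c: "c \<in> C" "real (Suc n) * norm (y - c) < s"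
      by auto
    have "real (Suc n) * norm (y - c) < real (Suc n) * e"
      using c(2) n \<open>e > 0\<close> by (simp add: algebra_simps)
    then have "norm (y - c) < e"
      by (simp del: of_nat_Suc)
    with c(1) show "\<exists>c\<in>C. dist c y < e"
      by (auto simp: dist_norm norm_minus_commute)
  qed
qed

text \<open>The set is the Minkowski sum of \<open>C\<close> and the ball of radius \<open>e\<close>
  about 0, and sums of convex sets are convex.\<close>

lemma convex_neighbourhood:
  fixes C :: "'a::real_normed_vector set"
  assumes "convex C"
  shows "convex {x. \<exists>a\<in>C. norm (x - a) < e}"
proof -
  have "{x. \<exists>a\<in>C. norm (x - a) < e} = (\<Union>a\<in>C. \<Union>b\<in>ball 0 e. {a + b})"
    by (force intro: exI[of _ "_ - _"])
  then show ?thesis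
    using convex_sums[OF assms convex_ball, of 0 e] by (simp add: UNION_singleton_eq_range)
qed

theorem theorem1:
  fixes A :: "nat \<Rightarrow> 'a::real_normed_vector set"
    and \<epsilon> :: "nat \<Rightarrow> real"
  assumes "\<And>n. convex (A n)"
    and "\<And>n. nowhere_dense (A n)"
    and "\<And>n. \<epsilon> n > 0"
    and "\<epsilon> \<longlonglongrightarrow> 0"
  shows "convex {x. \<forall>n. \<exists>a\<in>A n. norm (x - a) < \<epsilon> n} \<and>
         nowhere_dense {x. \<forall>n. \<exists>a\<in>A n. norm (x - a) < \<epsilon> n}"
proof
  let ?S = "{x. \<forall>n. \<exists>a\<in>A n. norm (x - a) < \<epsilon> n}"
  have "?S = (\<Inter>n. {x. \<exists>a\<in>A n. norm (x - a) < \<epsilon> n})"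
    by auto
  then show "convex ?S"
    using convex_neighbourhood[OF assms(1)] by (simp add: convex_INT)
  show "nowhere_dense ?S"
    unfolding nowhere_dense_def
  proof (rule ccontr)
    assume "interior (closure ?S) \<noteq> {}"
    then obtain x r where r: "r > 0" "ball x r \<subseteq> closure ?S"
      by (auto simp: mem_interior)
    have "eventually (\<lambda>n. \<epsilon> n < r / 2) sequentially"
      by (rule order_tendstoD(2)[OF assms(4)]) (use r(1) in simp)
    then obtain n where "\<epsilon> n < r / 2"
      unfolding eventually_sequentially by blast
    then have n: "2 * \<epsilon> n < r"
      by simp
    \<comment> \<open>One \<open>\<epsilon> n\<close> pays for moving from the closure to a point of
      \<open>?S\<close>, the other for moving from there to \<open>A n\<close>.\<close>
    have near: "\<exists>c\<in>A n. norm (z - c) < 2 * \<epsilon> n" if "z \<in> closure ?S" for z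
    proof -
      from that obtain w where w: "w \<in> ?S" "dist w z < \<epsilon> n"
        using assms(3) by (meson closure_approachable)
      then obtain c where c: "c \<in> A n" "norm (w - c) < \<epsilon> n"
        by blast
      have "norm (z - c) \<le> norm (z - w) + norm (w - c)"
        using norm_triangle_ineq[of "z - w" "w - c"] by simp
      with w(2) c show ?thesis
        by (intro bexI[of _ c]) (auto simp: dist_norm norm_minus_commute)
    qed
    \<comment> \<open>The radius is cut by \<open>2 * \<epsilon> n\<close> so that every shift
      \<open>y + b\<close> tested by the cancellation lemma stays in \<open>ball x r\<close>, where
      \<open>near\<close> applies.\<close>
    have "y \<in> closure (A n)" if y: "y \<in> ball x (r - 2 * \<epsilon> n)" for y
    proof (rule convex_cancel_ball[OF assms(1)])
      show "2 * \<epsilon> n > 0"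
        using assms(3) by simp
      fix b :: 'a
      assume "norm b < 2 * \<epsilon> n"
      moreover have "dist x (y + b) \<le> dist x y + norm b"
        using norm_triangle_ineq4[of "x - y" b] by (simp add: dist_norm diff_diff_eq)
      ultimately have "y + b \<in> ball x r"
        using y by simp
      with r(2) near show "\<exists>c\<in>A n. norm (y + b - c) < 2 * \<epsilon> n"
        by blast
    qed
    then have "x \<in> interior (closure (A n))"
      unfolding mem_interior using n by (intro exI[of _ "r - 2 * \<epsilon> n"]) auto
    with assms(2)[of n] show False
      by (simp add: nowhere_dense_def)
  qed
qed

end
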